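(* Let $H$ be a finite group and let $m$ be any odd positive integer. Then every cyclic D-sequence in $H$ has a lift by $\mathbb{Z}_m$ that is a cyclic D-sequence in $H\times\mathbb{Z}_m$.
   Context: All groups are finite; $1_G$ denotes the identity of a group $G$; $\mathbb{Z}_m$ is the cyclic group of order $m$. For a sequence ${\bf g}: g_0,\ldots,g_l$ in a group $G$ with $g_0=1_G$, the sequence of consecutive quotients ${\bf \bar g}:\bar g_0,\ldots,\bar g_l$ is defined by $\bar g_0=1_G$ and $\bar g_i=g_{i-1}^{-1}g_i$ for $1\le i\le l$. A D-sequence in a finite group $G$ of order $n$ is a sequence ${\bf g}: g_0,\ldots,g_{2n-1}$ in $G$ with $g_0=1_G$ such that every element of $G$ appears exactly twice in each of ${\bf g}$ and ${\bf \bar g}$. A D-sequence is cyclic if $g_{2n-1}=1_G$. Let $H$ be a group of order $n$, $K$ a group of order $k$, ${\bf h}: h_0,\ldots,h_{2n-1}$ a D-sequence in $H$ and ${\bf g}: g_0,\ldots,g_{2kn-1}$ a D-sequence in $G=H\times K$. Then ${\bf g}$ is a lift of ${\bf h}$ by $K$ if $\pi(g_{i+2tn})=h_i$ for all $0\le i\le 2n-1$ and $0\le t\le k-1$, where $\pi:G\to H$ is the projection onto the first component. *)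

theory Defs
  imports "HOL-Algebra.Elementary_Groups"
begin

text \<open>
  A finite sequence \<open>g\<^sub>0, \<dots>, g\<^sub>l\<close> is represented by a function \<open>g :: nat \<Rightarrow> 'a\<close> of which only the
  values at indices \<open>0, \<dots>, l\<close> matter. The notions below are meant for finite groups.
\<close>

definition quotient_seq :: "('a, 'b) monoid_scheme \<Rightarrow> (nat \<Rightarrow> 'a) \<Rightarrow> nat \<Rightarrow> 'a" where
  "quotient_seq G g i = (if i = 0 then \<one>\<^bsub>G\<^esub> else inv\<^bsub>G\<^esub> (g (i - 1)) \<otimes>\<^bsub>G\<^esub> g i)"

definition D_sequence :: "('a, 'b) monoid_scheme \<Rightarrow> (nat \<Rightarrow> 'a) \<Rightarrow> bool" where
  "D_sequence G g \<longleftrightarrow>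
     (\<forall>i < 2 * order G. g i \<in> carrier G) \<and>
     g 0 = \<one>\<^bsub>G\<^esub> \<and>
     (\<forall>x \<in> carrier G.
        card {i. i < 2 * order G \<and> g i = x} = 2 \<and>
        card {i. i < 2 * order G \<and> quotient_seq G g i = x} = 2)"

definition cyclic_D_sequence :: "('a, 'b) monoid_scheme \<Rightarrow> (nat \<Rightarrow> 'a) \<Rightarrow> bool" where
  "cyclic_D_sequence G g \<longleftrightarrow> D_sequence G g \<and> g (2 * order G - 1) = \<one>\<^bsub>G\<^esub>"

definition is_lift ::
  "('a, 'c) monoid_scheme \<Rightarrow> ('b, 'd) monoid_scheme \<Rightarrow> (nat \<Rightarrow> 'a) \<Rightarrow> (nat \<Rightarrow> 'a \<times> 'b) \<Rightarrow> bool" where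
  "is_lift H K h g \<longleftrightarrow>
     D_sequence H h \<and> D_sequence (H \<times>\<times> K) g \<and>
     (\<forall>i < 2 * order H. \<forall>t < order K. fst (g (i + 2 * t * order H)) = h i)"

end

theory Submission
  imports Defs
begin

text \<open>
  Write \<open>N\<close> for twice the order of \<open>H\<close> and split an index \<open>j\<close> as \<open>j = i + t * N\<close> with
  \<open>i < N\<close> and \<open>t < m\<close>. The first component of a lift is forced to be \<open>h i\<close>. Since \<open>h\<close> starts and
  ends in the identity, running through \<open>h\<close> again and again produces the quotients of \<open>h\<close>
  periodically, also across the seams between two consecutive rounds. It therefore suffices to choose
  the second component such that, for each fixed \<open>i\<close>, both its values and its successive differences
  run through all of \<open>\<int>\<^sub>m\<close> exactly once as \<open>t\<close> varies: every pair \<open>(x, c)\<close> is then taken as often as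
  \<open>x\<close> is taken in one round, that is, twice (\<open>card_fibre_of_sections\<close>).

  The choice \<open>t\<close> for even \<open>i\<close> and \<open>2 * (t + 1)\<close> for odd \<open>i\<close> does this. As functions of \<open>t\<close> the values
  have slopes \<open>1\<close> and \<open>2\<close>, and the differences have slopes \<open>1\<close> and \<open>-1\<close>; all of these are units
  modulo the odd number \<open>m\<close> (\<open>bij_betw_affine_mod\<close>). The offset in \<open>2 * (t + 1)\<close> makes the last
  entry vanish, so that the lift is cyclic.
\<close>

lemma bij_betw_affine_mod:
  fixes a b :: int and m :: nat
  assumes "coprime a (int m)" and "m > 0"
  shows "bij_betw (\<lambda>t. (a * int t + b) mod int m) {..<m} {0..<int m}"
proof -
  let ?f = "\<lambda>t. (a * int t + b) mod int m"
  have inj: "inj_on ?f {..<m}"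
  proof (rule inj_onI)
    fix s t assume st: "s \<in> {..<m}" "t \<in> {..<m}" and "?f s = ?f t"
    then have "int m dvd (a * int s + b) - (a * int t + b)"
      by (simp only: mod_eq_dvd_iff)
    then have "int m dvd a * (int s - int t)"
      by (simp add: algebra_simps)
    then have "int m dvd int s - int t"
      using assms(1) by (simp add: coprime_commute coprime_dvd_mult_right_iff)
    then have "int s mod int m = int t mod int m"
      by (simp add: mod_eq_dvd_iff)
    with st show "s = t" by simp
  qed
  have "?f ` {..<m} = {0..<int m}"
    by (rule card_subset_eq) (use assms(2) inj in \<open>auto simp: card_image\<close>)
  with inj show ?thesis by (simp add: bij_betw_def)
qed

text \<open>
  Each round index \<open>i\<close> with \<open>a i = x\<close> contributes exactly one index of the fibre over \<open>(x, c)\<close>,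
  namely the one in the unique round \<open>t\<close> at which the second component is \<open>c\<close>; so reduction
  modulo \<open>N\<close> is a bijection between the two sets.
\<close>

lemma card_fibre_of_sections:
  fixes f :: "nat \<Rightarrow> 'a \<times> 'c" and a :: "nat \<Rightarrow> 'a" and N m :: nat
  assumes fst: "\<And>i t. i < N \<Longrightarrow> t < m \<Longrightarrow> fst (f (i + t * N)) = a i"
    and snd: "\<And>i. i < N \<Longrightarrow> bij_betw (\<lambda>t. snd (f (i + t * N))) {..<m} C"
    and "c \<in> C"
  shows "card {j. j < m * N \<and> f j = (x, c)} = card {i. i < N \<and> a i = x}"
proof -
  have split: "j mod N < N" "j div N < m" "j mod N + j div N * N = j" if "j < m * N" for j
    using that by (auto simp: less_mult_imp_div_less intro!: mod_less_divisor gr0I)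
  have "bij_betw (\<lambda>j. j mod N) {j. j < m * N \<and> f j = (x, c)} {i. i < N \<and> a i = x}"
  proof (rule bij_betw_imageI)
    show "inj_on (\<lambda>j. j mod N) {j. j < m * N \<and> f j = (x, c)}"
    proof (rule inj_onI, clarify)
      fix j k assume jk: "j < m * N" "k < m * N" "f j = (x, c)" "f k = (x, c)" "j mod N = k mod N"
      have "snd (f (j mod N + j div N * N)) = snd (f (j mod N + k div N * N))"
        using jk split[of j] split[of k] by metis
      then have "j div N = k div N"
        using inj_onD[OF bij_betw_imp_inj_on[OF snd[OF split(1)[OF jk(1)]]]]
          split(2)[OF jk(1)] split(2)[OF jk(2)] by blast
      with jk(5) show "j = k" by (metis div_mult_mod_eq)
    qed
    show "(\<lambda>j. j mod N) ` {j. j < m * N \<and> f j = (x, c)} = {i. i < N \<and> a i = x}" (is "?L = ?R")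
    proof (rule equalityI)
      show "?L \<subseteq> ?R"
        using fst split by (smt (verit) fst_conv image_subset_iff mem_Collect_eq)
      show "?R \<subseteq> ?L"
      proof
        fix i assume "i \<in> ?R"
        then have i: "i < N" "a i = x" by auto
        obtain t where t: "t < m" "snd (f (i + t * N)) = c"
          using snd[OF i(1)] \<open>c \<in> C\<close> by (auto simp: bij_betw_def image_iff)
        have "i + t * N < Suc t * N" using i by simp
        also have "\<dots> \<le> m * N" using t by (intro mult_right_mono) auto
        finally show "i \<in> ?L"
          using i t fst[OF i(1) t(1)] by (intro image_eqI[of _ _ "i + t * N"]) (auto simp: prod_eq_iff)
      qed
    qed
  qed
  then show ?thesis by (rule bij_betw_same_card)
qed

text \<open>
  The second component of the lift. The parity of \<open>j\<close> is that of its position within a round,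
  because a round has even length \<open>N\<close>.
\<close>

definition zigzag :: "nat \<Rightarrow> nat \<Rightarrow> nat \<Rightarrow> int" where
  "zigzag N m j =
     (if even j then int (j div N) else 2 * int (j div N) + 2) mod int m"

lemma bij_betw_zigzag:
  assumes "odd m" and "even N" and "i < N"
  shows "bij_betw (\<lambda>t. zigzag N m (i + t * N)) {..<m} {0..<int m}"
proof -
  have m: "m > 0" using \<open>odd m\<close> by (rule odd_pos)
  have "coprime 2 (int m)" using \<open>odd m\<close> by simp
  with bij_betw_affine_mod[OF _ m, of 2 2] bij_betw_affine_mod[OF _ m, of 1 0] assms show ?thesis
    by (cases "even i") (simp_all add: zigzag_def)
qed

text \<open>
  At index \<open>0\<close> the left-hand side is the convention that a quotient sequence starts with the identity.
  It fits the pattern of the other seams, as the last entry of the cyclic sequence is \<open>0\<close> as well.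
\<close>

lemma zigzag_diff:
  assumes "even N" and "i < N"
  shows "(if i + t * N = 0 then 0
          else (zigzag N m (i + t * N) - zigzag N m (i + t * N - 1)) mod int m)
         = (if odd i then int t + 2 else if i = 0 then - int t else - int t - 2) mod int m"
proof (cases "i = 0")
  case False
  then have "i + t * N - 1 = (i - 1) + t * N" by simp
  with False assms show ?thesis
    by (auto simp: zigzag_def mod_diff_eq div_add1_eq simp del: add_diff_assoc2)
next
  case True
  show ?thesis
  proof (cases t)
    case (Suc s)
    \<comment> \<open>A seam: the preceding index is the last one, of odd position, of round \<open>s\<close>.\<close>
    from True Suc assms have "i + t * N - 1 = (N - 1) + s * N" by simp
    moreover have "((N - 1) + s * N) div N = s"
      using div_mult_self1[of N "N - 1" s] assms by simp
    moreover from assms have "odd ((N - 1) + s * N)" by (cases N) auto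
    ultimately show ?thesis
      using True Suc assms by (simp add: zigzag_def mod_diff_eq algebra_simps)
  qed (use True in simp)
qed

theorem lemma9:
  fixes H :: "('a, 'b) monoid_scheme" and m :: nat and h :: "nat \<Rightarrow> 'a"
  assumes "group H" and "finite (carrier H)"
    and "odd m"
    and "cyclic_D_sequence H h"
  shows "\<exists>g. is_lift H (integer_mod_group m) h g \<and>
             cyclic_D_sequence (H \<times>\<times> integer_mod_group m) g"
proof -
  interpret H: group H by fact
  define Z where "Z = integer_mod_group m"
  define N where "N = 2 * order H"
  define g where "g j = (h (j mod N), zigzag N m j)" for j
  let ?G = "H \<times>\<times> Z"
  have m: "m > 0" using \<open>odd m\<close> by (rule odd_pos)
  have N: "N > 0" "even N"
    using assms(2) by (auto simp: N_def H.order_gt_0_iff_finite)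
  interpret Z: group Z by (simp add: Z_def)
  have carrier_Z: "carrier Z = {0..<int m}" and one_Z: "\<one>\<^bsub>Z\<^esub> = 0" and order_Z: "order Z = m"
    using m by (auto simp: Z_def carrier_integer_mod_group order_def)
  have order_G: "2 * order ?G = m * N"
    by (simp add: order_def N_def order_Z[unfolded order_def] card_cartesian_product)
  from assms(4) have h: "\<And>i. i < N \<Longrightarrow> h i \<in> carrier H" "h 0 = \<one>\<^bsub>H\<^esub>" "h (N - 1) = \<one>\<^bsub>H\<^esub>"
    and twice: "\<And>x. x \<in> carrier H \<Longrightarrow> card {i. i < N \<and> h i = x} = 2"
      "\<And>x. x \<in> carrier H \<Longrightarrow> card {i. i < N \<and> quotient_seq H h i = x} = 2"
    by (auto simp: cyclic_D_sequence_def D_sequence_def N_def)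
  have g_closed: "g j \<in> carrier ?G" for j
    using h(1) N m by (simp add: g_def zigzag_def carrier_Z)
  have g0: "g 0 = \<one>\<^bsub>?G\<^esub>"
    by (simp add: g_def zigzag_def h one_Z)
  have g_last: "g (m * N - 1) = \<one>\<^bsub>?G\<^esub>"
  proof -
    have eq: "m * N - 1 = (N - 1) + (m - 1) * N"
      using m N by (cases m) auto
    moreover have "odd ((N - 1) + (m - 1) * N)" using N by (cases N) auto
    moreover have "2 * int (m - 1) + 2 = 2 * int m" using m by simp
    moreover have "((N - 1) + (m - 1) * N) div N = m - 1"
      using div_mult_self1[of N "N - 1" "m - 1"] N by simp
    moreover have "((N - 1) + (m - 1) * N) mod N = N - 1"
      using N by (simp only: mod_mult_self1) simp
    ultimately show ?thesis
      unfolding g_def zigzag_def eq using h(3) by (simp only: one_Z one_DirProd if_False mod_mult_self2_is_0)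
  qed

  \<comment> \<open>The first component repeats with period \<open>N\<close>: at a seam the quotient is taken between the last
    and the first entry of \<open>h\<close>, which are both the identity, in accordance with
    \<open>quotient_seq H h 0\<close>.\<close>
  have quot: "quotient_seq ?G g (i + t * N) = (quotient_seq H h i,
      (if odd i then int t + 2 else if i = 0 then - int t else - int t - 2) mod int m)"
    if i: "i < N" for i t
  proof -
    let ?j = "i + t * N"
    have "fst (quotient_seq ?G g ?j) = quotient_seq H h i"
    proof (cases "i = 0")
      case False
      then have "(?j - 1) mod N = i - 1"
        using i by (metis Nat.add_diff_assoc2 Suc_leI less_imp_diff_less mod_less mod_mult_self1 neq0_conv One_nat_def)
      with False i h(1) show ?thesis
        using g_closed[of "?j - 1"]
        by (simp add: quotient_seq_def g_def inv_DirProd H.is_group Z.is_group)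
    next
      case True
      show ?thesis
      proof (cases t)
        case (Suc s)
        from True Suc N have "?j - 1 = (N - 1) + s * N" by simp
        then have "(?j - 1) mod N = N - 1" using N by (simp only: mod_mult_self1) simp
        with True Suc N h g_closed[of "?j - 1"] show ?thesis
          by (simp add: quotient_seq_def g_def inv_DirProd H.is_group Z.is_group)
      qed (use True in \<open>simp add: quotient_seq_def\<close>)
    qed
    moreover have "snd (quotient_seq ?G g ?j) =
        (if ?j = 0 then 0 else (zigzag N m ?j - zigzag N m (?j - 1)) mod int m)"
    proof -
      have "zigzag N m (?j - 1) \<in> carrier Z"
        using m by (simp add: zigzag_def carrier_Z)
      then show ?thesis
        using g_closed[of "?j - 1"]
        by (auto simp: quotient_seq_def g_def inv_DirProd H.is_group Z.is_group one_Z)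
           (auto simp: Z_def mod_add_left_eq)
    qed
    ultimately show ?thesis
      using zigzag_diff[OF N(2) i, of t m] by (simp add: prod_eq_iff)
  qed

  have "card {j. j < m * N \<and> g j = (x, c)} = 2" if "x \<in> carrier H" "c \<in> carrier Z" for x c
    using card_fibre_of_sections[of N m g h "{0..<int m}" c x]
      bij_betw_zigzag[OF assms(3) N(2)] that twice(1)
    by (simp add: g_def carrier_Z)
  moreover
  have "card {j. j < m * N \<and> quotient_seq ?G g j = (x, c)} = 2"
    if "x \<in> carrier H" "c \<in> carrier Z" for x c
  proof -
    have "bij_betw (\<lambda>t. snd (quotient_seq ?G g (i + t * N))) {..<m} {0..<int m}" if "i < N" for i
      using quot[OF that] bij_betw_affine_mod[OF _ m, of 1 2]
        bij_betw_affine_mod[OF _ m, of "- 1" 0] bij_betw_affine_mod[OF _ m, of "- 1" "- 2"]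
      by (cases "odd i"; cases "i = 0") simp_all
    then show ?thesis
      using card_fibre_of_sections[of N m "quotient_seq ?G g" "quotient_seq H h" "{0..<int m}" c x]
        quot that twice(2)
      by (simp add: carrier_Z)
  qed
  ultimately have D: "D_sequence ?G g"
    unfolding D_sequence_def order_G using g_closed g0 by auto
  moreover have "fst (g (i + 2 * t * order H)) = h i" if "i < 2 * order H" for i t
  proof -
    have eq: "i + 2 * t * order H = i + t * N" by (simp add: N_def)
    show ?thesis unfolding eq using that by (simp add: g_def N_def[symmetric])
  qed
  ultimately have "is_lift H Z h g"
    using assms(4) by (simp add: is_lift_def cyclic_D_sequence_def)
  moreover have "cyclic_D_sequence ?G g"
    using D g_last by (simp only: cyclic_D_sequence_def order_G simp_thms)
  ultimately show ?thesis unfolding Z_def by blast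
qed

end
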